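(* Let $N\ge2$ be an integer, $\delta=1/N^2$, $h=N\delta=1/N$, and $\nu\in(0,h)$. For integers $j$ put $t_j=jh$, $t_j^\delta=jh+\delta$, $G^j=[jh,jh+\delta]$, $I^j=[jh+\delta,(j+1)h]$, and let $\phi:\mathbb R\to\mathbb R$ be the piecewise function $$\phi(t)=\begin{cases}jh+\nu\,S\big(\frac{t-jh}{\delta}\big),& t\in G^j,\\ jh+\nu+(h-\nu)\,P\big(\frac{t-jh-\delta}{h-\delta}\big),& t\in I^j,\end{cases}\qquad j\in\mathbb Z,$$ where $S(z)=z-\frac1{2\pi}\sin(2\pi z)$ and $P(z)=z^3(6z^2-15z+10)$ for $z\in[0,1]$. Then: (i) $\phi\in C^2$ is strictly increasing, and for every integer $j$ $$\phi(t_j)=t_j,\quad \phi(t_j^\delta)=t_j+\nu,\quad \phi'(t_j)=\phi''(t_j)=\phi'(t_j^\delta)=\phi''(t_j^\delta)=0.$$ (ii) For every integer $j$, on $G^j$, $$\max_{t\in G^j}\phi(t)\le jh+\nu,\quad \max_{t\in G^j}|\phi'(t)|\le 2\,\frac{\nu}{\delta},\quad \max_{t\in G^j}|\phi''(t)|\le 2\pi\,\frac{\nu}{\delta^2},$$ and on $I^j$, $$\max_{t\in I^j}\phi(t)\le (j+1)h,\quad \max_{t\in I^j}|\phi'(t)|\le\frac{15}{8}\,\frac{h-\nu}{h-\delta},\quad \max_{t\in I^j}|\phi''(t)|\le\frac{10}{\sqrt3}\,\frac{h-\nu}{(h-\delta)^2}.$$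
   Context: All objects are defined in the claim; $C^2$ means twice continuously differentiable on $\mathbb R$. *)

theory Defs
  imports "HOL-Analysis.Analysis"
begin

definition S_profile :: "real \<Rightarrow> real" where
  "S_profile z = z - 1 / (2 * pi) * sin (2 * pi * z)"

definition P_profile :: "real \<Rightarrow> real" where
  "P_profile z = z ^ 3 * (6 * z\<^sup>2 - 15 * z + 10)"

definition G_int :: "real \<Rightarrow> real \<Rightarrow> int \<Rightarrow> real set" where
  "G_int h \<delta> j = {of_int j * h .. of_int j * h + \<delta>}"

definition I_int :: "real \<Rightarrow> real \<Rightarrow> int \<Rightarrow> real set" where
  "I_int h \<delta> j = {of_int j * h + \<delta> .. (of_int j + 1) * h}"

text \<open>The closed intervals overlap at their end points. The definition picks the period
  \<open>[jh, (j+1)h)\<close> containing \<open>t\<close>; the lemmas \<open>phi_on_G\<close> and \<open>phi_on_I\<close> show that both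
  branch formulas hold on the whole closed intervals.\<close>

definition phi :: "real \<Rightarrow> real \<Rightarrow> real \<Rightarrow> real \<Rightarrow> real" where
  "phi h \<delta> \<nu> t =
    (let j = \<lfloor>t / h\<rfloor> in
     if t \<in> G_int h \<delta> j
     then of_int j * h + \<nu> * S_profile ((t - of_int j * h) / \<delta>)
     else of_int j * h + \<nu> + (h - \<nu>) * P_profile ((t - of_int j * h - \<delta>) / (h - \<delta>)))"

lemma phi_on_G:
  assumes "0 < \<delta>" "\<delta> < h" "t \<in> G_int h \<delta> j"
  shows "phi h \<delta> \<nu> t = of_int j * h + \<nu> * S_profile ((t - of_int j * h) / \<delta>)"
proof -
  have "\<lfloor>t / h\<rfloor> = j"
    using assms by (intro floor_unique) (auto simp: G_int_def field_simps)
  then show ?thesis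
    using assms by (simp add: phi_def Let_def)
qed

lemma phi_on_I:
  assumes "0 < \<delta>" "\<delta> < h" "t \<in> I_int h \<delta> j"
  shows "phi h \<delta> \<nu> t =
    of_int j * h + \<nu> + (h - \<nu>) * P_profile ((t - of_int j * h - \<delta>) / (h - \<delta>))"
proof (cases "t = (of_int j + 1) * h")
  case True
  have t: "t = of_int (j + 1) * h" using True by simp
  have "t \<in> G_int h \<delta> (j + 1)"
    using assms t by (simp add: G_int_def)
  then have "phi h \<delta> \<nu> t = t"
    using phi_on_G[OF assms(1,2), of t "j + 1"] t by (simp add: S_profile_def)
  moreover have "t - of_int j * h - \<delta> = h - \<delta>"
    using True by (simp add: algebra_simps)
  ultimately show ?thesis
    using assms True by (simp add: P_profile_def algebra_simps)
next
  case False
  have "t < (of_int j + 1) * h" using False assms by (simp add: I_int_def)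
  then have fl: "\<lfloor>t / h\<rfloor> = j"
    using assms by (intro floor_unique) (auto simp: I_int_def field_simps)
  show ?thesis
  proof (cases "t = of_int j * h + \<delta>")
    case True
    then have "t \<in> G_int h \<delta> j" using assms by (simp add: G_int_def)
    with True show ?thesis
      using assms by (simp add: phi_on_G S_profile_def P_profile_def)
  next
    case False
    then have "t \<notin> G_int h \<delta> j" using assms by (simp add: G_int_def I_int_def)
    with fl show ?thesis by (simp add: phi_def Let_def)
  qed
qed

definition C2_real :: "(real \<Rightarrow> real) \<Rightarrow> bool" where
  "C2_real f \<longleftrightarrow>
    (\<forall>x. f differentiable (at x)) \<and>
    (\<forall>x. deriv f differentiable (at x)) \<and>
    continuous_on UNIV (deriv (deriv f))"

text \<open>The maximum of \<open>f\<close> over \<open>A\<close> is attained and is at most \<open>b\<close>. The library's \<open>Max\<close> is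
  meaningful for finite sets only.\<close>

definition max_on_le :: "(real \<Rightarrow> real) \<Rightarrow> real set \<Rightarrow> real \<Rightarrow> bool" where
  "max_on_le f A b \<longleftrightarrow> (\<exists>s\<in>A. (\<forall>t\<in>A. f t \<le> f s) \<and> f s \<le> b)"

end

theory Submission imports Defs begin

text \<open>The pieces and their first two derivatives agree at the breakpoints, so they glue to a
  \<open>C\<^sup>2\<close> function. The bounds come from the profiles
  \<open>S' = 1 - cos (2\<pi>z)\<close>, \<open>S'' = 2\<pi> sin (2\<pi>z)\<close>, \<open>P' = 30z\<^sup>2(1-z)\<^sup>2\<close> and
  \<open>P'' = 60z(1-z)(1-2z)\<close>; \<open>S'\<close> and \<open>P'\<close> are positive on the open unit interval, which makes
  \<open>\<phi>\<close> strictly increasing.\<close>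

section \<open>Auxiliary calculus and bounds for the derivatives of the quintic profile\<close>

lemma has_real_derivative_Un_within:
  assumes "(f has_real_derivative D) (at x within S)" "(f has_real_derivative D) (at x within T)"
  shows "(f has_real_derivative D) (at x within S \<union> T)"
  using assms by (simp add: has_field_derivative_iff Lim_within_Un)

lemma quarter_bound:
  fixes z :: real
  shows "z * (1 - z) \<le> 1 / 4"
proof -
  have "0 \<le> (z - 1 / 2)\<^sup>2" by simp
  then show ?thesis by (simp add: power2_eq_square algebra_simps)
qed

text \<open>The expression is 30 times the square of \<open>z * (1 - z)\<close>, which is at most
  1/4 and nonnegative here; 30/16 is 15/8.\<close>

lemma P_profile_deriv_bound:
  fixes z :: real
  assumes "0 \<le> z" "z \<le> 1"
  shows "\<bar>30 * z\<^sup>2 * (1 - z)\<^sup>2\<bar> \<le> 15 / 8"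
proof -
  have "(z * (1 - z))\<^sup>2 \<le> (1 / 4)\<^sup>2"
    using assms by (intro power_mono quarter_bound) auto
  then show ?thesis by (simp add: power_mult_distrib[of z] power_divide)
qed

text \<open>Squaring removes the sign and the root. With \<open>w = (1 - 2 * z)\<^sup>2\<close> one
  has 4z(1-z) = 1 - w, so the square is 225 w(1-w)^2, whose maximum for w in [0,1] is 225 * 4/27 =
  100/3, at w = 1/3.\<close>

lemma P_profile_deriv2_bound:
  fixes z :: real
  assumes "0 \<le> z" "z \<le> 1"
  shows "\<bar>60 * z * (1 - z) * (1 - 2 * z)\<bar> \<le> 10 / sqrt 3"
proof (rule power2_le_imp_le)
  define w where "w = (1 - 2 * z)\<^sup>2"
  have "z * (1 - z) \<ge> 0" using assms by simp
  then have "w \<le> 1" by (simp add: w_def power2_eq_square algebra_simps)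
  \<comment> \<open>This is the factorization of 4/27 - w(1-w)^2, which has a double root at the
    maximizer 1/3.\<close>
  then have "0 \<le> (1 / 3 - w)\<^sup>2 * (4 / 3 - w)" by simp
  also have "\<dots> = 4 / 27 - w * (1 - w)\<^sup>2" by (simp add: power2_eq_square field_simps)
  finally have "225 * (w * (1 - w)\<^sup>2) \<le> 100 / 3" by simp
  moreover have "\<bar>60 * z * (1 - z) * (1 - 2 * z)\<bar>\<^sup>2 = 225 * (w * (1 - w)\<^sup>2)"
    unfolding w_def power2_abs by algebra
  ultimately show "\<bar>60 * z * (1 - z) * (1 - 2 * z)\<bar>\<^sup>2 \<le> (10 / sqrt 3)\<^sup>2"
    by (simp add: power_divide)
qed simp

lemma max_on_le_compact:
  assumes "compact A" "A \<noteq> {}" "continuous_on A f" "\<And>t. t \<in> A \<Longrightarrow> f t \<le> b"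
  shows "max_on_le f A b"
  using continuous_attains_sup[OF assms(1-3)] assms(4) by (auto simp: max_on_le_def)

text \<open>The derivatives of \<open>phi\<close> have the same shape as \<open>phi\<close>, with profiles \<open>u\<close>, \<open>v\<close> on the rescaled
  intervals and no translation from one period to the next.\<close>

definition periodic_glue :: "real \<Rightarrow> real \<Rightarrow> (real \<Rightarrow> real) \<Rightarrow> (real \<Rightarrow> real) \<Rightarrow> real \<Rightarrow> real" where
  "periodic_glue h \<delta> u v t =
    (let s = t - of_int \<lfloor>t / h\<rfloor> * h in if s \<le> \<delta> then u (s / \<delta>) else v ((s - \<delta>) / (h - \<delta>)))"

section \<open>Gluing along the periodic partition\<close>

context
  fixes h \<delta> :: real
  assumes \<delta>: "0 < \<delta>" "\<delta> < h"
begin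

lemma periodic_glue_on_G:
  assumes "t \<in> G_int h \<delta> j"
  shows "periodic_glue h \<delta> u v t = u ((t - of_int j * h) / \<delta>)"
proof -
  have "\<lfloor>t / h\<rfloor> = j"
    using assms \<delta> by (intro floor_unique) (auto simp: G_int_def field_simps)
  then show ?thesis using assms by (simp add: periodic_glue_def G_int_def Let_def)
qed

text \<open>At its two end points the closed interval falls under the other branch: the left one has
  s = \<delta>, where \<open>u 1\<close> is taken, and the right one opens the next period, where
  \<open>u 0\<close> is taken. The conditions on \<open>u\<close> and \<open>v\<close> match exactly
  these values.\<close>

lemma periodic_glue_on_I:
  assumes t: "t \<in> I_int h \<delta> j" and uv: "u 1 = v 0" "v 1 = u 0"
  shows "periodic_glue h \<delta> u v t = v ((t - of_int j * h - \<delta>) / (h - \<delta>))"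
proof (cases "t = (of_int j + 1) * h")
  case True
  then have "t \<in> G_int h \<delta> (j + 1)" using \<delta> by (simp add: G_int_def)
  from periodic_glue_on_G[OF this] True \<delta> uv show ?thesis by (simp add: algebra_simps)
next
  case False
  then have "\<lfloor>t / h\<rfloor> = j"
    using t \<delta> by (intro floor_unique) (auto simp: I_int_def field_simps)
  moreover from t have "t - of_int j * h = \<delta> \<or> t - of_int j * h > \<delta>"
    by (auto simp: I_int_def)
  ultimately show ?thesis
    using uv \<delta> by (auto simp: periodic_glue_def Let_def)
qed

lemma unit_coordinate_I: "t \<in> I_int h \<delta> j \<Longrightarrow> (t - of_int j * h - \<delta>) / (h - \<delta>) \<in> {0..1}"
  using \<delta> by (auto simp: I_int_def field_simps)

text \<open>One period is not a neighbourhood of its left end point, so the preceding period is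
  added. Four closed pieces thus surround any point.\<close>

lemma two_periods:
  obtains j :: int where "x \<in> interior (\<Union>i\<in>{j - 1, j}. G_int h \<delta> i \<union> I_int h \<delta> i)"
proof
  define j where "j = \<lfloor>x / h\<rfloor>"
  have "of_int j \<le> x / h" "x / h < of_int j + 1" unfolding j_def by linarith+
  then have j: "of_int j * h \<le> x" "x < (of_int j + 1) * h"
    using \<delta> by (simp_all add: field_simps)
  have "(\<Union>i\<in>{j - 1, j}. G_int h \<delta> i \<union> I_int h \<delta> i) = {(of_int j - 1) * h..(of_int j + 1) * h}"
    using \<delta> by (auto simp: G_int_def I_int_def algebra_simps)
  moreover have "x \<in> interior {(of_int j - 1) * h..(of_int j + 1) * h}"
    using j \<delta> by (simp add: algebra_simps)
  ultimately show "x \<in> interior (\<Union>i\<in>{\<lfloor>x / h\<rfloor> - 1, \<lfloor>x / h\<rfloor>}. G_int h \<delta> i \<union> I_int h \<delta> i)"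
    by (simp add: j_def)
qed

lemma closed_G: "closed (G_int h \<delta> j)" and closed_I: "closed (I_int h \<delta> j)"
  by (simp_all add: G_int_def I_int_def)

text \<open>Using one \<open>f'\<close> for both families of pieces encodes that the one-sided
  derivatives match at the breakpoints. The four pieces of two consecutive periods then give the
  derivative within a neighbourhood of \<open>x\<close>.\<close>

lemma has_real_derivative_glue:
  assumes G: "\<And>j x. x \<in> G_int h \<delta> j \<Longrightarrow> (f has_real_derivative f' x) (at x within G_int h \<delta> j)"
    and I: "\<And>j x. x \<in> I_int h \<delta> j \<Longrightarrow> (f has_real_derivative f' x) (at x within I_int h \<delta> j)"
  shows "(f has_real_derivative f' x) (at x)"
proof -
  \<comment> \<open>Outside a closed piece the filter \<open>at x within\<close> that piece is trivial.\<close>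
  have GI: "(f has_real_derivative f' x) (at x within A)"
    if "A = G_int h \<delta> j \<or> A = I_int h \<delta> j" for A j
  proof (cases "x \<in> A")
    case True
    with that G I show ?thesis by blast
  next
    case False
    with that closed_G[of j] closed_I[of j] have "at x within A = bot"
      by (metis closed_limpt trivial_limit_within)
    then show ?thesis by (simp add: has_field_derivative_iff)
  qed
  obtain j where x: "x \<in> interior (\<Union>i\<in>{j - 1, j}. G_int h \<delta> i \<union> I_int h \<delta> i)"
    by (rule two_periods)
  have "(f has_real_derivative f' x)
    (at x within (\<Union>i\<in>{j - 1, j}. G_int h \<delta> i \<union> I_int h \<delta> i))"
    by (simp, intro has_real_derivative_Un_within GI) auto
  then show ?thesis using at_within_interior[OF x] by simp
qed

lemma continuous_on_glue:
  assumes "\<And>j. continuous_on (G_int h \<delta> j) f" "\<And>j. continuous_on (I_int h \<delta> j) f"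
  shows "continuous_on UNIV f"
proof (rule continuous_at_imp_continuous_on, rule ballI)
  fix x
  obtain j where x: "x \<in> interior (\<Union>i\<in>{j - 1, j}. G_int h \<delta> i \<union> I_int h \<delta> i)"
    by (rule two_periods)
  have "continuous_on (\<Union>i\<in>{j - 1, j}. G_int h \<delta> i \<union> I_int h \<delta> i) f"
    using assms by (simp add: continuous_on_closed_Un closed_Un closed_G closed_I)
  then show "isCont f x" using x by (rule continuous_on_interior)
qed

end

section \<open>The derivatives of \<open>phi\<close> and its C2 regularity\<close>

context
  fixes h \<delta> \<nu> :: real
  assumes \<delta>: "0 < \<delta>" "\<delta> < h" and \<nu>: "0 < \<nu>" "\<nu> < h"
begin

text \<open>By the chain rule, the prefactor is the rise of \<open>phi\<close> over a piece divided
  by the length of that piece; each further derivative divides by the length once more.\<close>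

definition phi_deriv :: "real \<Rightarrow> real" where
  "phi_deriv = periodic_glue h \<delta> (\<lambda>z. \<nu> / \<delta> * (1 - cos (2 * pi * z)))
    (\<lambda>z. (h - \<nu>) / (h - \<delta>) * (30 * z\<^sup>2 * (1 - z)\<^sup>2))"

definition phi_deriv2 :: "real \<Rightarrow> real" where
  "phi_deriv2 = periodic_glue h \<delta> (\<lambda>z. \<nu> / \<delta>\<^sup>2 * (2 * pi * sin (2 * pi * z)))
    (\<lambda>z. (h - \<nu>) / (h - \<delta>)\<^sup>2 * (60 * z * (1 - z) * (1 - 2 * z)))"

lemma phi_deriv_on_G: "t \<in> G_int h \<delta> j \<Longrightarrow>
    phi_deriv t = \<nu> / \<delta> * (1 - cos (2 * pi * ((t - of_int j * h) / \<delta>)))"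
  unfolding phi_deriv_def by (rule periodic_glue_on_G[OF \<delta>])

lemma phi_deriv_on_I: "t \<in> I_int h \<delta> j \<Longrightarrow> phi_deriv t = (h - \<nu>) / (h - \<delta>) *
    (30 * ((t - of_int j * h - \<delta>) / (h - \<delta>))\<^sup>2 * (1 - (t - of_int j * h - \<delta>) / (h - \<delta>))\<^sup>2)"
  \<comment> \<open>The matching conditions hold because S' and P' both vanish at 0 and 1.\<close>
  unfolding phi_deriv_def by (rule periodic_glue_on_I[OF \<delta>]) auto

lemma phi_deriv2_on_G: "t \<in> G_int h \<delta> j \<Longrightarrow>
    phi_deriv2 t = \<nu> / \<delta>\<^sup>2 * (2 * pi * sin (2 * pi * ((t - of_int j * h) / \<delta>)))"
  unfolding phi_deriv2_def by (rule periodic_glue_on_G[OF \<delta>])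

lemma phi_deriv2_on_I: "t \<in> I_int h \<delta> j \<Longrightarrow> phi_deriv2 t = (h - \<nu>) / (h - \<delta>)\<^sup>2 *
    (60 * ((t - of_int j * h - \<delta>) / (h - \<delta>)) * (1 - (t - of_int j * h - \<delta>) / (h - \<delta>))
      * (1 - 2 * ((t - of_int j * h - \<delta>) / (h - \<delta>))))"
  unfolding phi_deriv2_def by (rule periodic_glue_on_I[OF \<delta>]) auto

lemma phi_has_derivative: "(phi h \<delta> \<nu> has_real_derivative phi_deriv x) (at x)"
proof (rule has_real_derivative_glue[OF \<delta>])
  fix j x assume x: "x \<in> G_int h \<delta> j"
  have "((\<lambda>t. of_int j * h + \<nu> * S_profile ((t - of_int j * h) / \<delta>)) has_real_derivative phi_deriv x)
      (at x within G_int h \<delta> j)"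
    unfolding S_profile_def phi_deriv_on_G[OF x] using \<delta>
    by (auto intro!: derivative_eq_intros simp: field_simps)
  then show "(phi h \<delta> \<nu> has_real_derivative phi_deriv x) (at x within G_int h \<delta> j)"
    \<comment> \<open>The formula equals \<open>phi\<close> on the whole closed piece, so any radius
      serves in the transfer; 1 is taken.\<close>
    by (rule has_field_derivative_transform_within[OF _ zero_less_one x]) (simp add: phi_on_G \<delta>)
next
  fix j x assume x: "x \<in> I_int h \<delta> j"
  have "(P_profile has_real_derivative 30 * z\<^sup>2 * (1 - z)\<^sup>2) (at z)" for z
    unfolding P_profile_def
    by (rule derivative_eq_intros refl | simp)+ (simp add: power2_eq_square power3_eq_cube algebra_simps)
  note P = DERIV_chain2[OF this]
  have "((\<lambda>t. of_int j * h + \<nu> + (h - \<nu>) * P_profile ((t - of_int j * h - \<delta>) / (h - \<delta>)))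
      has_real_derivative phi_deriv x) (at x within I_int h \<delta> j)"
    unfolding phi_deriv_on_I[OF x] using \<delta>
    by (auto intro!: derivative_eq_intros P)
  then show "(phi h \<delta> \<nu> has_real_derivative phi_deriv x) (at x within I_int h \<delta> j)"
    by (rule has_field_derivative_transform_within[OF _ zero_less_one x]) (simp add: phi_on_I \<delta>)
qed

lemma phi_deriv_has_derivative: "(phi_deriv has_real_derivative phi_deriv2 x) (at x)"
proof (rule has_real_derivative_glue[OF \<delta>])
  fix j x assume x: "x \<in> G_int h \<delta> j"
  have "((\<lambda>t. \<nu> / \<delta> * (1 - cos (2 * pi * ((t - of_int j * h) / \<delta>)))) has_real_derivative phi_deriv2 x)
      (at x within G_int h \<delta> j)"
    unfolding phi_deriv2_on_G[OF x] using \<delta>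
    by (auto intro!: derivative_eq_intros simp: field_simps power2_eq_square)
  then show "(phi_deriv has_real_derivative phi_deriv2 x) (at x within G_int h \<delta> j)"
    by (rule has_field_derivative_transform_within[OF _ zero_less_one x]) (simp add: phi_deriv_on_G)
next
  fix j x assume x: "x \<in> I_int h \<delta> j"
  have "((\<lambda>z. 30 * z\<^sup>2 * (1 - z)\<^sup>2) has_real_derivative 60 * z * (1 - z) * (1 - 2 * z)) (at z)"
    for z :: real
    by (rule derivative_eq_intros refl | simp)+ (simp add: power2_eq_square power3_eq_cube algebra_simps)
  note P = DERIV_chain2[OF this]
  have "((\<lambda>t. (h - \<nu>) / (h - \<delta>) *
      (30 * ((t - of_int j * h - \<delta>) / (h - \<delta>))\<^sup>2 * (1 - (t - of_int j * h - \<delta>) / (h - \<delta>))\<^sup>2))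
      has_real_derivative (h - \<nu>) / (h - \<delta>) * (60 * ((x - of_int j * h - \<delta>) / (h - \<delta>))
        * (1 - (x - of_int j * h - \<delta>) / (h - \<delta>))
        * (1 - 2 * ((x - of_int j * h - \<delta>) / (h - \<delta>))) * (1 / (h - \<delta>)))) (at x within I_int h \<delta> j)"
    by (intro DERIV_cmult P) (use \<delta> in \<open>auto intro!: derivative_eq_intros\<close>)
  \<comment> \<open>The inner derivative \<open>1 / (h - \<delta>)\<close> is absorbed into the
    squared denominator of \<open>phi_deriv2\<close>.\<close>
  then have "((\<lambda>t. (h - \<nu>) / (h - \<delta>) *
      (30 * ((t - of_int j * h - \<delta>) / (h - \<delta>))\<^sup>2 * (1 - (t - of_int j * h - \<delta>) / (h - \<delta>))\<^sup>2))
      has_real_derivative phi_deriv2 x) (at x within I_int h \<delta> j)"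
    by (rule DERIV_cong) (simp add: phi_deriv2_on_I[OF x] power2_eq_square)
  then show "(phi_deriv has_real_derivative phi_deriv2 x) (at x within I_int h \<delta> j)"
    by (rule has_field_derivative_transform_within[OF _ zero_less_one x]) (simp add: phi_deriv_on_I)
qed

lemma continuous_phi_deriv2: "continuous_on UNIV phi_deriv2"
proof (rule continuous_on_glue[OF \<delta>])
  fix j
  show "continuous_on (G_int h \<delta> j) phi_deriv2"
    by (subst continuous_on_cong[OF refl phi_deriv2_on_G]) (use \<delta> in \<open>auto intro!: continuous_intros\<close>)
  show "continuous_on (I_int h \<delta> j) phi_deriv2"
    by (subst continuous_on_cong[OF refl phi_deriv2_on_I]) (use \<delta> in \<open>auto intro!: continuous_intros\<close>)
qed

lemma deriv_phi: "deriv (phi h \<delta> \<nu>) = phi_deriv"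
  using phi_has_derivative by (blast intro: DERIV_imp_deriv)

lemma deriv_phi_deriv: "deriv phi_deriv = phi_deriv2"
  using phi_deriv_has_derivative by (blast intro: DERIV_imp_deriv)

lemma C2_phi: "C2_real (phi h \<delta> \<nu>)"
  unfolding C2_real_def deriv_phi deriv_phi_deriv real_differentiable_def
  using phi_has_derivative phi_deriv_has_derivative continuous_phi_deriv2 by blast

section \<open>Strict monotonicity\<close>

lemma phi_deriv_nonneg: "phi_deriv x \<ge> 0"
  using \<delta> \<nu> by (simp add: phi_deriv_def periodic_glue_def Let_def)

text \<open>The derivative vanishes at every breakpoint, so positivity is only available on a dense
  set. Going right from \<open>x\<close> but staying short of the end of its piece gives a rescaled
  coordinate strictly between 0 and 1, where S' and P' are positive.\<close>

lemma phi_deriv_pos_between: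
  assumes "x < y"
  obtains z where "x < z" "z < y" "phi_deriv z > 0"
proof -
  define j where "j = \<lfloor>x / h\<rfloor>"
  have "of_int j \<le> x / h" "x / h < of_int j + 1" unfolding j_def by linarith+
  then have j: "of_int j * h \<le> x" "x < (of_int j + 1) * h"
    using \<delta> by (simp_all add: field_simps)
  show ?thesis
  proof (cases "x < of_int j * h + \<delta>")
    case True
    then obtain z where z: "x < z" "z < min y (of_int j * h + \<delta>)"
      using assms dense[of x "min y (of_int j * h + \<delta>)"] by auto
    define s where "s = (z - of_int j * h) / \<delta>"
    have "z \<in> G_int h \<delta> j" "0 < s" "s < 1"
      using z j \<delta> by (auto simp: G_int_def s_def field_simps)
    moreover have "cos (2 * pi * s) < 1"
    proof -
      \<comment> \<open>Used through 1 - cos(2a) = 2 sin(a)^2 with a =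
        \<open>pi * s\<close>.\<close>
      have "sin (pi * s) > 0"
        using \<open>0 < s\<close> \<open>s < 1\<close> by (intro sin_gt_zero) auto
      then show ?thesis using cos_double_sin[of "pi * s"] by (simp add: mult.assoc)
    qed
    ultimately have "phi_deriv z > 0"
      using \<delta> \<nu> by (simp add: phi_deriv_on_G s_def)
    then show ?thesis using z that by simp
  next
    case False
    obtain z where z: "x < z" "z < min y ((of_int j + 1) * h)"
      using assms j dense[of x "min y ((of_int j + 1) * h)"] by auto
    define s where "s = (z - of_int j * h - \<delta>) / (h - \<delta>)"
    have "z \<in> I_int h \<delta> j" "0 < s" "s < 1"
      using z j False \<delta> by (auto simp: I_int_def s_def field_simps)
    moreover from this have "30 * s\<^sup>2 * (1 - s)\<^sup>2 > 0" by simp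
    ultimately have "phi_deriv z > 0"
      using \<delta> \<nu> by (simp only: phi_deriv_on_I s_def) simp
    then show ?thesis using z that by simp
  qed
qed

lemma mono_phi: "x \<le> y \<Longrightarrow> phi h \<delta> \<nu> x \<le> phi h \<delta> \<nu> y"
  using phi_has_derivative phi_deriv_nonneg by (meson DERIV_nonneg_imp_nondecreasing)

lemma strict_mono_phi: "strict_mono (phi h \<delta> \<nu>)"
proof (rule strict_monoI)
  fix x y :: real assume "x < y"
  then obtain z where z: "x < z" "z < y" "phi_deriv z > 0"
    by (rule phi_deriv_pos_between)
  \<comment> \<open>The strict gain occurs just to the right of \<open>z\<close>; weak monotonicity
    covers the rest of the way from \<open>x\<close> to \<open>y\<close>.\<close>
  obtain d where d: "d > 0" "\<And>e. 0 < e \<Longrightarrow> e < d \<Longrightarrow> phi h \<delta> \<nu> z < phi h \<delta> \<nu> (z + e)"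
    using DERIV_pos_inc_right[OF phi_has_derivative z(3)] by auto
  \<comment> \<open>Halving keeps \<open>e\<close> strictly below \<open>d\<close>, and the second
    bound keeps \<open>z + e\<close> from passing \<open>y\<close>.\<close>
  define e where "e = min (d / 2) (y - z)"
  have "0 < e" "e < d" "z + e \<le> y" using d(1) z by (auto simp: e_def)
  have "phi h \<delta> \<nu> x \<le> phi h \<delta> \<nu> z" using z by (intro mono_phi) simp
  also have "\<dots> < phi h \<delta> \<nu> (z + e)" by (rule d(2)) fact+
  also have "\<dots> \<le> phi h \<delta> \<nu> y" by (rule mono_phi) fact
  finally show "phi h \<delta> \<nu> x < phi h \<delta> \<nu> y" .
qed

section \<open>Breakpoint values and bounds on the pieces\<close>

lemma endpoints_in_intervals:
  "of_int j * h \<in> G_int h \<delta> j" "of_int j * h + \<delta> \<in> G_int h \<delta> j" "(of_int j + 1) * h \<in> I_int h \<delta> j"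
  using \<delta> by (auto simp: G_int_def I_int_def algebra_simps)

text \<open>Both points are ends of the same \<open>G_int h \<delta> j\<close>, so the sine branch
  at coordinates 0 and 1 yields all six values.\<close>

lemma phi_breakpoints:
  "phi h \<delta> \<nu> (of_int j * h) = of_int j * h"
  "phi h \<delta> \<nu> (of_int j * h + \<delta>) = of_int j * h + \<nu>"
  "phi_deriv (of_int j * h) = 0" "phi_deriv2 (of_int j * h) = 0"
  "phi_deriv (of_int j * h + \<delta>) = 0" "phi_deriv2 (of_int j * h + \<delta>) = 0"
  using \<delta> endpoints_in_intervals(1,2)[of j]
  by (simp_all add: phi_on_G phi_deriv_on_G phi_deriv2_on_G S_profile_def)

lemma phi_bound_G: "t \<in> G_int h \<delta> j \<Longrightarrow> phi h \<delta> \<nu> t \<le> of_int j * h + \<nu>"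
  using mono_phi[of t "of_int j * h + \<delta>"] by (simp add: phi_breakpoints G_int_def)

text \<open>By monotonicity the right end decides, and that end is the breakpoint with index
  \<open>j + 1\<close>.\<close>

lemma phi_bound_I: "t \<in> I_int h \<delta> j \<Longrightarrow> phi h \<delta> \<nu> t \<le> (of_int j + 1) * h"
  using mono_phi[of t "(of_int j + 1) * h"] phi_breakpoints(1)[of "j + 1"] by (simp add: I_int_def)

lemma phi_deriv_bound_G: "\<bar>phi_deriv t\<bar> \<le> 2 * (\<nu> / \<delta>)" if "t \<in> G_int h \<delta> j"
proof -
  have "\<bar>1 - cos a\<bar> \<le> 2" for a :: real
    using cos_ge_minus_one[of a] cos_le_one[of a] by linarith
  then show ?thesis
    unfolding phi_deriv_on_G[OF that] abs_mult mult.commute[of 2]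
    using \<delta> \<nu> by (intro mult_mono) auto
qed

lemma phi_deriv2_bound_G: "\<bar>phi_deriv2 t\<bar> \<le> 2 * pi * (\<nu> / \<delta>\<^sup>2)" if "t \<in> G_int h \<delta> j"
  \<comment> \<open>Both sides are arranged as prefactor times profile term, so that
    \<open>mult_mono\<close> compares them factor by factor.\<close>
  unfolding phi_deriv2_on_G[OF that] abs_mult[of "\<nu> / \<delta>\<^sup>2"] mult.commute[of "2 * pi" "\<nu> / \<delta>\<^sup>2"]
  using \<delta> \<nu> by (intro mult_mono) (auto simp: abs_mult)

lemma phi_deriv_bound_I: "\<bar>phi_deriv t\<bar> \<le> 15 / 8 * ((h - \<nu>) / (h - \<delta>))" if "t \<in> I_int h \<delta> j"
  unfolding phi_deriv_on_I[OF that] abs_mult[of "(h - \<nu>) / (h - \<delta>)"] mult.commute[of "15 / 8"]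
  using \<delta> \<nu> unit_coordinate_I[OF \<delta> that]
  by (intro mult_mono P_profile_deriv_bound) auto

lemma phi_deriv2_bound_I: "\<bar>phi_deriv2 t\<bar> \<le> 10 / sqrt 3 * ((h - \<nu>) / (h - \<delta>)\<^sup>2)"
  if "t \<in> I_int h \<delta> j"
  unfolding phi_deriv2_on_I[OF that] abs_mult[of "(h - \<nu>) / (h - \<delta>)\<^sup>2"] mult.commute[of "10 / sqrt 3"]
  using \<delta> \<nu> unit_coordinate_I[OF \<delta> that]
  by (intro mult_mono P_profile_deriv2_bound) auto

text \<open>Compactness and continuity supply the maximizer, which reduces each claim about a
  maximum to a pointwise bound.\<close>

lemma max_on_le_intervals:
  assumes "continuous_on UNIV f"
  shows "(\<And>t. t \<in> G_int h \<delta> j \<Longrightarrow> f t \<le> b) \<Longrightarrow> max_on_le f (G_int h \<delta> j) b"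
    and "(\<And>t. t \<in> I_int h \<delta> j \<Longrightarrow> f t \<le> b) \<Longrightarrow> max_on_le f (I_int h \<delta> j) b"
  using endpoints_in_intervals[of j] continuous_on_subset[OF assms]
  by (auto intro!: max_on_le_compact simp: G_int_def I_int_def)

lemma continuous_phi:
  "continuous_on UNIV (phi h \<delta> \<nu>)"
  "continuous_on UNIV (\<lambda>t. \<bar>phi_deriv t\<bar>)"
  "continuous_on UNIV (\<lambda>t. \<bar>phi_deriv2 t\<bar>)"
  using phi_has_derivative phi_deriv_has_derivative continuous_phi_deriv2
  by (auto intro!: continuous_on_rabs intro: DERIV_continuous_on)

end

theorem lemma2p1:
  fixes N :: nat and \<delta> h \<nu> :: real and \<phi> :: "real \<Rightarrow> real"
  assumes "N \<ge> 2"
    and "\<delta> = 1 / (real N)\<^sup>2"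
    and "h = real N * \<delta>"
    and "0 < \<nu>" and "\<nu> < h"
    and "\<phi> = phi h \<delta> \<nu>"
  shows "C2_real \<phi> \<and> strict_mono \<phi> \<and>
    (\<forall>j::int.
      \<phi> (of_int j * h) = of_int j * h \<and>
      \<phi> (of_int j * h + \<delta>) = of_int j * h + \<nu> \<and>
      deriv \<phi> (of_int j * h) = 0 \<and>
      deriv (deriv \<phi>) (of_int j * h) = 0 \<and>
      deriv \<phi> (of_int j * h + \<delta>) = 0 \<and>
      deriv (deriv \<phi>) (of_int j * h + \<delta>) = 0) \<and>
    (\<forall>j::int.
      max_on_le \<phi> (G_int h \<delta> j) (of_int j * h + \<nu>) \<and>
      max_on_le (\<lambda>t. \<bar>deriv \<phi> t\<bar>) (G_int h \<delta> j) (2 * (\<nu> / \<delta>)) \<and>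
      max_on_le (\<lambda>t. \<bar>deriv (deriv \<phi>) t\<bar>) (G_int h \<delta> j) (2 * pi * (\<nu> / \<delta>\<^sup>2)) \<and>
      max_on_le \<phi> (I_int h \<delta> j) ((of_int j + 1) * h) \<and>
      max_on_le (\<lambda>t. \<bar>deriv \<phi> t\<bar>) (I_int h \<delta> j) (15 / 8 * ((h - \<nu>) / (h - \<delta>))) \<and>
      max_on_le (\<lambda>t. \<bar>deriv (deriv \<phi>) t\<bar>) (I_int h \<delta> j)
        (10 / sqrt 3 * ((h - \<nu>) / (h - \<delta>)\<^sup>2)))"
proof -
  \<comment> \<open>Here \<open>h\<close> is 1/N and \<open>\<delta>\<close> is 1/N^2, so
    \<open>N \<ge> 2\<close> makes the second inequality strict.\<close>
  have \<delta>: "0 < \<delta>" "\<delta> < h"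
    unfolding assms(2,3) using \<open>N \<ge> 2\<close> by (simp_all add: power2_eq_square field_simps)
  note ctx = \<delta> assms(4,5)
  show ?thesis
    unfolding assms(6) deriv_phi[OF ctx] deriv_phi_deriv[OF ctx]
    by (intro conjI allI C2_phi[OF ctx] strict_mono_phi[OF ctx] phi_breakpoints[OF ctx]
        max_on_le_intervals[OF ctx] continuous_phi[OF ctx]
        phi_bound_G[OF ctx] phi_bound_I[OF ctx] phi_deriv_bound_G[OF ctx] phi_deriv_bound_I[OF ctx]
        phi_deriv2_bound_G[OF ctx] phi_deriv2_bound_I[OF ctx])
qed

end
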